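(* Let $n\ge3$, let $r_2,\dots,r_n$ be positive integers, and put $m=\sum_{i=2}^n r_i$. Let $\Lambda,B_2,\dots,B_n\in\mathbb{C}[u_2,\dots,u_n]$ and set $$\mu(B_2,\dots,B_n,\Lambda)=\Lambda\,\mathrm{Jac}_u(B_2,\dots,B_n)+\sum_{i=2}^n r_iB_i\,\mathrm{Jac}_u(B_2,\dots,\Lambda,\dots,B_n),$$ the $i$-th summand having $\Lambda$ in the $i$-th slot (in place of $B_i$). Then $$\mathrm{Jac}_u\bigl(B_2\Lambda^{r_2},\dots,B_n\Lambda^{r_n}\bigr)=\Lambda^{\,m-1}\,\mu(B_2,\dots,B_n,\Lambda).$$ Consequently, if $B_j\in V_j$ for all $j$, the polynomial map $$G=\bigl(x\Lambda(u),\;x^{-r_2}B_2(u),\;\dots,\;x^{-r_n}B_n(u)\bigr)\colon\mathbb{C}^n\to\mathbb{C}^n,\qquad u_i=x^{r_i}y_i,$$ in the source coordinates $x,y_2,\dots,y_n$, is a Keller map if and only if $\mu(B_2,\dots,B_n,\Lambda)=\kappa$ for some $\kappa\in\mathbb{C}^\times$. Moreover $\mu$ is multilinear, of multidegree $(1,1,\dots,1)$ in its $n$ arguments $B_2,\dots,B_n,\Lambda$.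
   Context: $\mathrm{Jac}_u(f_2,\dots,f_n)=\det(\partial f_i/\partial u_j)_{2\le i,j\le n}$. $V_j=\mathrm{span}_{\mathbb{C}}\{u_2^{b_2}\cdots u_n^{b_n}:\sum_i r_ib_i\ge r_j\}$, which is exactly the condition that $x^{-r_j}B_j(x^{r_2}y_2,\dots,x^{r_n}y_n)$ is a polynomial. Maps $G$ of this form are exactly the polynomial maps whose components are weight-homogeneous of weights $1,-r_2,\dots,-r_n$ for the grading $\mathrm{wt}(x)=1$, $\mathrm{wt}(y_i)=-r_i$. A Keller map is a polynomial map whose Jacobian determinant is a nonzero constant. *)

theory Defs
  imports "HOL-Analysis.Determinants" "HOL-Library.Poly_Mapping"
begin

text \<open>
  Polynomials over the complex numbers in variables indexed by \<open>'v\<close>: finitely supported functions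
  from exponent vectors to coefficients, with the convolution product of
  \<^theory>\<open>HOL-Library.Poly_Mapping\<close>.

  The variables \<open>u\<^sub>2, \<dots>, u\<^sub>n\<close> are indexed by a finite type \<open>'n\<close>, so that \<open>n = CARD('n option)\<close>.
  The source coordinates \<open>x, y\<^sub>2, \<dots>, y\<^sub>n\<close> are indexed by \<open>'n option\<close>, with \<open>None\<close>
  for \<open>x\<close> and \<open>Some i\<close> for \<open>y\<^sub>i\<close>.
\<close>

type_synonym 'v cpoly = "('v \<Rightarrow>\<^sub>0 nat) \<Rightarrow>\<^sub>0 complex"

definition Const :: "complex \<Rightarrow> 'v cpoly" where
  "Const c = Poly_Mapping.single 0 c"

definition Var :: "'v \<Rightarrow> 'v cpoly" where
  "Var v = Poly_Mapping.single (Poly_Mapping.single v 1) 1"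

definition scale :: "complex \<Rightarrow> 'v cpoly \<Rightarrow> 'v cpoly" where
  "scale c p = Const c * p"

text \<open>The subtraction of exponents below is truncated, but only where the coefficient vanishes.\<close>

definition partial_deriv :: "'v \<Rightarrow> 'v cpoly \<Rightarrow> 'v cpoly" where
  "partial_deriv v p =
     (\<Sum>b\<in>Poly_Mapping.keys p.
        Poly_Mapping.single (b - Poly_Mapping.single v 1)
          (of_nat (Poly_Mapping.lookup b v) * Poly_Mapping.lookup p b))"

definition subst :: "('v \<Rightarrow> 'w cpoly) \<Rightarrow> 'v cpoly \<Rightarrow> 'w cpoly" where
  "subst \<sigma> p =
     (\<Sum>b\<in>Poly_Mapping.keys p.
        Const (Poly_Mapping.lookup p b) *
        (\<Prod>v\<in>Poly_Mapping.keys b. \<sigma> v ^ Poly_Mapping.lookup b v))"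

definition Jac :: "('v::finite \<Rightarrow> 'v cpoly) \<Rightarrow> 'v cpoly" where
  "Jac f = det (\<chi> i j. partial_deriv j (f i))"

text \<open>A polynomial self-map of affine space is given by its tuple of component polynomials.\<close>

definition keller_map :: "('v::finite \<Rightarrow> 'v cpoly) \<Rightarrow> bool" where
  "keller_map F \<longleftrightarrow> (\<exists>c. c \<noteq> 0 \<and> Jac F = Const c)"

definition V :: "('n::finite \<Rightarrow> nat) \<Rightarrow> 'n \<Rightarrow> 'n cpoly set" where
  "V r j = module.span scale
     {Poly_Mapping.single b 1 | b. (\<Sum>i\<in>UNIV. r i * Poly_Mapping.lookup b i) \<ge> r j}"

definition mu :: "('n::finite \<Rightarrow> nat) \<Rightarrow> ('n \<Rightarrow> 'n cpoly) \<Rightarrow> 'n cpoly \<Rightarrow> 'n cpoly" where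
  "mu r B \<Lambda> = \<Lambda> * Jac B + (\<Sum>i\<in>UNIV. of_nat (r i) * B i * Jac (B(i := \<Lambda>)))"

definition u :: "('n \<Rightarrow> nat) \<Rightarrow> 'n \<Rightarrow> 'n option cpoly" where
  "u r i = Var None ^ r i * Var (Some i)"

text \<open>
  The component \<open>x\<^sup>-\<^sup>r\<^sup>j B\<^sub>j(u)\<close> is the polynomial quotient of \<open>B\<^sub>j(u)\<close> by the power of \<open>x\<close> with
  exponent \<open>r j\<close>. The quotient is unique if it exists, and it exists exactly when
  \<open>B j \<in> V r j\<close>; the definition is meaningful only in that case.
\<close>

fun G :: "('n::finite \<Rightarrow> nat) \<Rightarrow> ('n \<Rightarrow> 'n cpoly) \<Rightarrow> 'n cpoly \<Rightarrow> 'n option \<Rightarrow> 'n option cpoly" where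
  "G r B \<Lambda> None = Var None * subst (u r) \<Lambda>"
| "G r B \<Lambda> (Some j) = (THE q. Var None ^ r j * q = subst (u r) (B j))"

lemma vector_space_scale: "vector_space (scale :: complex \<Rightarrow> 'v cpoly \<Rightarrow> 'v cpoly)"
  by unfold_locales
    (simp_all add: scale_def Const_def algebra_simps single_add mult_single
      flip: mult.assoc)

definition multilinear :: "(('k \<Rightarrow> 'v cpoly) \<Rightarrow> 'v cpoly) \<Rightarrow> bool" where
  "multilinear F \<longleftrightarrow> (\<forall>A k. Vector_Spaces.linear scale scale (\<lambda>p. F (A(k := p))))"

definition multihomogeneous ::
  "('k::finite \<Rightarrow> nat) \<Rightarrow> (('k \<Rightarrow> 'v cpoly) \<Rightarrow> 'v cpoly) \<Rightarrow> bool" where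
  "multihomogeneous d F \<longleftrightarrow>
     (\<forall>c A. F (\<lambda>k. scale (c k) (A k)) = scale (\<Prod>k\<in>UNIV. c k ^ d k) (F A))"

end

theory Submission
  imports Defs
begin

text \<open>
  All claims follow from one description of \<open>\<mu>\<close>. Let the arguments be \<open>A\<^sub>1 = \<Lambda>\<close> and \<open>A\<^sub>j = B\<^sub>j\<close> for
  \<open>j \<ge> 2\<close>, with weights \<open>\<omega>\<^sub>1 = 1\<close> and \<open>\<omega>\<^sub>j = - r\<^sub>j\<close>. Then \<open>\<mu>\<close> is the determinant of the matrix of size
  \<open>n\<close> whose \<open>i\<close>-th row is \<open>(\<omega>\<^sub>i A\<^sub>i, \<partial>\<^sub>2 A\<^sub>i, \<dots>, \<partial>\<^sub>n A\<^sub>i)\<close>: its expansion along the first column is the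
  definition of \<open>\<mu>\<close> (lemma \<open>mu_eq_weighted_Jac\<close>). Each row is linear in its own argument, so
  multilinearity and multihomogeneity are properties of determinants.

  The Jacobian determinant of \<open>G\<close> equals \<open>\<mu>(u)\<close> (lemmas \<open>Jac_weight_homogeneous\<close> and \<open>Jac_G\<close>). The
  vector field \<open>x \<partial>\<^sub>x - \<Sum> r\<^sub>k y\<^sub>k \<partial>\<^sub>y\<^sub>k\<close> annihilates every \<open>u\<^sub>i\<close> and multiplies a component of weight \<open>\<omega>\<close>
  by \<open>\<omega>\<close>. Putting the derivatives along this field in place of the column of \<open>\<partial>\<^sub>x\<close> turns the Jacobian
  matrix of \<open>G\<close> into the matrix above, evaluated at \<open>u\<close>, up to powers of \<open>x\<close> that multiply rows and
  columns. These powers cancel because the weights of \<open>G\<close> have the same sum \<open>1 - m\<close> as those of the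
  coordinates \<open>x, y\<^sub>2, \<dots>, y\<^sub>n\<close>. As the substitution of \<open>u\<close> is injective and fixes the constants, \<open>G\<close> is
  a Keller map exactly when \<open>\<mu>\<close> is a nonzero constant.

  The identity for the Jacobian of the \<open>B\<^sub>i \<Lambda>\<^bsup>r\<^sub>i\<^esup>\<close> (lemma \<open>Jac_mult_powers\<close>) is the formula for the
  determinant of a rank-one update (lemma \<open>det_rank_one_update\<close>), which holds over every commutative
  ring. It also yields the expansion along a column.
\<close>

section \<open>Determinants over a commutative ring\<close>

text \<open>
  The rows are modified one at a time. When row \<open>k\<close> is modified, linearity splits off the determinant
  in which that row is \<open>w\<close>. There the multiples of \<open>w\<close> that were added to the other rows change
  nothing: by the induction hypothesis they contribute only determinants with two rows equal to \<open>w\<close>.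
\<close>

lemma det_rank_one_update_on:
  fixes a :: "'n::finite \<Rightarrow> 'a::comm_ring_1 ^ 'n"
  assumes "finite S"
  shows "det (\<chi> i. if i \<in> S then a i + c i *s w else a i)
       = det (\<chi> i. a i) + (\<Sum>k\<in>S. c k * det (\<chi> i. if i = k then w else a i))"
  using assms
proof (induction S arbitrary: a)
  case empty
  show ?case by simp
next
  case (insert k S)
  define f where "f i = (if i \<in> S then a i + c i *s w else a i)" for i
  have vanish: "det (\<chi> i. if i = j then w else (a(k := w)) i) = 0" if "j \<in> S" for j
  proof (rule det_identical_rows[of j k])
    show "j \<noteq> k" using that insert.hyps by auto
    show "row j (\<chi> i. if i = j then w else (a(k := w)) i)
        = row k (\<chi> i. if i = j then w else (a(k := w)) i)"
      by (auto simp: row_def vec_eq_iff)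
  qed
  have "det (\<chi> i. if i \<in> insert k S then a i + c i *s w else a i)
      = det (\<chi> i. if i = k then a i + c k *s w else f i)"
    by (rule arg_cong[where f = det]) (auto simp: vec_eq_iff f_def)
  also have "\<dots> = det (\<chi> i. if i = k then a i else f i) + c k * det (\<chi> i. if i = k then w else f i)"
    using det_row_add[of k a "\<lambda>_. c k *s w" f] det_row_mul[of k "c k" "\<lambda>_. w" f] by simp
  also have "(\<chi> i. if i = k then a i else f i) = (\<chi> i. f i)"
    using insert.hyps by (auto simp: vec_eq_iff f_def)
  also have "det (\<chi> i. f i) = det (\<chi> i. a i) + (\<Sum>k\<in>S. c k * det (\<chi> i. if i = k then w else a i))"
    unfolding f_def by (rule insert.IH)
  also have "(\<chi> i. if i = k then w else f i)
           = (\<chi> i. if i \<in> S then (a(k := w)) i + c i *s w else (a(k := w)) i)"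
    using insert.hyps by (auto simp: vec_eq_iff f_def)
  also have "det \<dots> = det (\<chi> i. (a(k := w)) i)"
    unfolding insert.IH by (simp add: vanish del: fun_upd_apply)
  also have "(\<chi> i. (a(k := w)) i) = (\<chi> i. if i = k then w else a i)"
    by (auto simp: vec_eq_iff)
  finally show ?case
    using insert.hyps by (simp add: algebra_simps)
qed

lemma det_rank_one_update:
  fixes a :: "'n::finite \<Rightarrow> 'a::comm_ring_1 ^ 'n"
  shows "det (\<chi> i. a i + c i *s w)
       = det (\<chi> i. a i) + (\<Sum>k\<in>UNIV. c k * det (\<chi> i. if i = k then w else a i))"
  using det_rank_one_update_on[of UNIV a c w] by simp

lemma prod_option_UNIV:
  fixes f :: "'n::finite option \<Rightarrow> 'a::comm_monoid_mult"
  shows "prod f UNIV = f None * (\<Prod>i\<in>UNIV. f (Some i))"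
  by (simp add: UNIV_option_conv prod.reindex)

lemma sum_option_UNIV:
  fixes f :: "'n::finite option \<Rightarrow> 'a::comm_monoid_add"
  shows "sum f UNIV = f None + (\<Sum>i\<in>UNIV. f (Some i))"
  by (simp add: UNIV_option_conv sum.reindex)

text \<open>
  Only the permutations that fix \<open>None\<close> contribute to the Leibniz formula, and they are the
  permutations of the remaining indices.
\<close>

lemma det_block_lower:
  fixes A :: "'a::comm_ring_1 ^ 'n::finite option ^ 'n option"
  assumes "\<And>j. A $ None $ Some j = 0"
  shows "det A = A $ None $ None * det (\<chi> i j. A $ Some i $ Some j)"
proof -
  define t where "t p = of_int (sign p) * (\<Prod>i\<in>UNIV. A $ i $ p i)" for p
  define lift :: "('n \<Rightarrow> 'n) \<Rightarrow> 'n option \<Rightarrow> 'n option" where "lift = map_permutation UNIV Some"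
  have bij: "bij_betw lift {p. p permutes UNIV} {p. p permutes range Some}"
    using bij_betw_permutations[of Some UNIV "range Some"]
    by (simp add: lift_def map_permutation_def[abs_def] restrict_id_def[abs_def] bij_betw_def
        cong: if_cong)
  have t_lift: "t (lift p) = A $ None $ None *
      (of_int (sign p) * (\<Prod>i\<in>UNIV. (\<chi> i j. A $ Some i $ Some j) $ i $ p i))"
    if "p permutes UNIV" for p
  proof -
    have "sign (lift p) = sign p"
      unfolding lift_def by (rule sign_map_permutation) (use that in auto)
    moreover have "lift p (Some i) = Some (p i)" for i
      unfolding lift_def by (rule map_permutation_apply) auto
    moreover have "lift p None = None"
      by (auto simp: lift_def map_permutation_def restrict_id_def)
    ultimately show ?thesis
      by (simp add: t_def prod_option_UNIV)
  qed
  have "det A = (\<Sum>p | p permutes UNIV. t p)"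
    by (simp add: det_def t_def)
  also have "\<dots> = (\<Sum>p | p permutes range Some. t p)"
  proof (rule sum.mono_neutral_right)
    show "finite {p :: 'n option \<Rightarrow> 'n option. p permutes UNIV}" by (simp add: finite_permutations)
    show "{p :: 'n option \<Rightarrow> 'n option. p permutes range Some} \<subseteq> {p. p permutes UNIV}"
      using permutes_subset by blast
    show "\<forall>p\<in>{p. p permutes UNIV} - {p. p permutes range Some}. t p = 0"
    proof
      fix p :: "'n option \<Rightarrow> 'n option"
      assume p: "p \<in> {p. p permutes UNIV} - {p. p permutes range Some}"
      have "p None \<noteq> None"
      proof
        assume "p None = None"
        moreover have "p permutes UNIV" using p by simp
        moreover have "x = None" if "x \<in> UNIV - range Some" for x :: "'n option"
          using that by (cases x) auto
        ultimately have "p permutes range Some"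
          by (metis permutes_superset)
        then show False using p by simp
      qed
      then have "A $ None $ p None = 0"
        using assms by (cases "p None") auto
      then show "t p = 0"
        by (simp add: t_def prod_option_UNIV)
    qed
  qed
  also have "\<dots> = (\<Sum>p | p permutes UNIV. t (lift p))"
    by (rule sum.reindex_bij_betw[OF bij, symmetric])
  also have "\<dots> = A $ None $ None * det (\<chi> i j. A $ Some i $ Some j)"
    unfolding det_def sum_distrib_left by (rule sum.cong) (simp_all only: t_lift mem_Collect_eq)
  finally show ?thesis .
qed

lemma det_block_upper:
  fixes A :: "'a::comm_ring_1 ^ 'n::finite option ^ 'n option"
  assumes "\<And>i. A $ Some i $ None = 0"
  shows "det A = A $ None $ None * det (\<chi> i j. A $ Some i $ Some j)"
proof -
  have "det A = det (transpose A)" by simp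
  also have "\<dots> = A $ None $ None * det (\<chi> i j. transpose A $ Some i $ Some j)"
    by (subst det_block_lower) (use assms in \<open>auto simp: transpose_def\<close>)
  also have "(\<chi> i j. transpose A $ Some i $ Some j) = transpose (\<chi> i j. A $ Some i $ Some j)"
    by (simp add: transpose_def)
  finally show ?thesis by simp
qed

text \<open>
  The Laplace expansion along the column \<open>None\<close>, with the signs of the cofactors absorbed by putting
  the first row into the place of the deleted one.

  Replace the corner entry by \<open>1\<close>; this changes the determinant by a multiple of the lower right
  minor. The remaining matrix can be cleared below its corner: it is the product of a unipotent matrix
  and a block triangular matrix, and the lower right block of the latter is a rank-one update. The
  claim is then the formula for rank-one updates.
\<close>

lemma det_expand_None:
  fixes A :: "'a::comm_ring_1 ^ 'n::finite option ^ 'n option"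
  shows "det A = A $ None $ None * det (\<chi> i j. A $ Some i $ Some j)
    - (\<Sum>k\<in>UNIV. A $ Some k $ None *
        det (\<chi> i j. if i = k then A $ None $ Some j else A $ Some i $ Some j))"
proof -
  define w where "w = (\<chi> j. A $ None $ Some j)"
  define a where "a i = (\<chi> j. A $ Some i $ Some j)" for i
  define v where "v i = A $ Some i $ None" for i
  define L :: "'a ^ 'n option ^ 'n option" where
    "L = (\<chi> i j. if i = j then 1 else if j = None then v (the i) else 0)"
  define R :: "'a ^ 'n option ^ 'n option" where
    "R = (\<chi> i j. case i of None \<Rightarrow> (case j of None \<Rightarrow> 1 | Some j \<Rightarrow> w $ j)
        | Some i \<Rightarrow> (case j of None \<Rightarrow> 0 | Some j \<Rightarrow> (a i + (- v i) *s w) $ j))"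
  have LR: "(\<chi> i. if i = None then (\<chi> j. if j = None then 1 else A $ None $ j) else A $ i) = L ** R"
  proof -
    have "(if i = None then (\<chi> j. if j = None then 1 else A $ None $ j) else A $ i) $ j
        = (L ** R) $ i $ j" for i j
      by (cases i; cases j)
         (simp_all add: matrix_matrix_mult_def sum_option_UNIV L_def R_def w_def v_def a_def
            if_distrib[of "\<lambda>x. x * _"] cong: if_cong)
    then show ?thesis by (simp add: vec_eq_iff)
  qed
  have "det L = 1"
    by (subst det_block_lower) (auto simp: L_def det_diagonal)
  moreover have "det R = det (\<chi> i. a i + (- v i) *s w)"
  proof -
    have "(\<chi> i j. R $ Some i $ Some j) = (\<chi> i. a i + (- v i) *s w)"
      by (simp add: vec_eq_iff R_def)
    then show ?thesis
      by (subst det_block_upper) (simp_all add: R_def)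
  qed
  ultimately have "det (L ** R) = det (\<chi> i. a i + (- v i) *s w)"
    by (simp add: det_mul)
  also have "\<dots> = det (\<chi> i. a i) + (\<Sum>k\<in>UNIV. (- v k) * det (\<chi> i. if i = k then w else a i))"
    by (rule det_rank_one_update)
  finally have det_LR: "det (L ** R)
      = det (\<chi> i. a i) - (\<Sum>k\<in>UNIV. v k * det (\<chi> i. if i = k then w else a i))"
    by (simp add: sum_negf)
  define A2 where
    "A2 = (\<chi> i. if i = None then (\<chi> j. if j = None then A $ None $ None - 1 else 0) else A $ i)"
  have "(\<chi> i j. A2 $ Some i $ Some j) = (\<chi> i. a i)"
    by (simp add: A2_def a_def vec_eq_iff)
  then have det_A2: "det A2 = (A $ None $ None - 1) * det (\<chi> i. a i)"
    using det_block_lower[of A2] by (simp add: A2_def)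
  have "A = (\<chi> i. if i = None then (\<chi> j. if j = None then 1 else A $ None $ j)
      + (\<chi> j. if j = None then A $ None $ None - 1 else 0) else A $ i)"
    by (simp add: vec_eq_iff)
  then have "det A = det (L ** R) + det A2"
    unfolding A2_def LR[symmetric]
    using det_row_add[of None "\<lambda>_. \<chi> j. if j = None then 1 else A $ None $ j"
        "\<lambda>_. \<chi> j. if j = None then A $ None $ None - 1 else 0" "\<lambda>i. A $ i"]
    by argo
  then have "det A = A $ None $ None * det (\<chi> i. a i)
      - (\<Sum>k\<in>UNIV. v k * det (\<chi> i. if i = k then w else a i))"
    unfolding det_LR det_A2 by (simp add: left_diff_distrib)
  moreover have "(\<chi> i. if i = k then w else a i)
      = (\<chi> i j. if i = k then A $ None $ Some j else A $ Some i $ Some j)" for k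
    by (simp add: a_def w_def vec_eq_iff)
  ultimately show ?thesis
    by (simp only: v_def a_def)
qed

section \<open>Polynomials: induction, derivatives and substitution\<close>

abbreviation lookup where "lookup \<equiv> Poly_Mapping.lookup"
abbreviation single where "single \<equiv> Poly_Mapping.single"

text \<open>
  Two additive functions that agree on monomials agree everywhere; the Leibniz rule, the
  multiplicativity of substitution and the effect of the substitution \<^term>\<open>u r\<close> on coefficients
  are proved in this way.
\<close>

lemma cpoly_add_induct [case_names single add]:
  fixes p :: "'v cpoly"
  assumes single: "\<And>b c. P (single b c)"
    and add: "\<And>p q. P p \<Longrightarrow> P q \<Longrightarrow> P (p + q)"
  shows "P p"
proof (induction p rule: Poly_Mapping.update_induct)
  case const
  show ?case using single[of 0 0] by simp
next
  case (update p b c)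
  have "Poly_Mapping.update b c p = single b c + p"
    using update.hyps
    by (intro poly_mapping_eqI) (auto simp: lookup_update lookup_add lookup_single in_keys_iff when_def)
  then show ?case using add[OF single update.IH] by simp
qed

text \<open>
  Derivatives and substitutions are sums over the support of a polynomial, which is not additive. The
  sums are additive all the same, since a term with coefficient zero vanishes.
\<close>

lemma sum_keys_add:
  fixes p q :: "'v cpoly" and h :: "('v \<Rightarrow>\<^sub>0 nat) \<Rightarrow> complex \<Rightarrow> 'a::comm_monoid_add"
  assumes "\<And>b. h b 0 = 0" "\<And>b c d. h b (c + d) = h b c + h b d"
  shows "(\<Sum>b\<in>Poly_Mapping.keys (p + q). h b (lookup (p + q) b))
       = (\<Sum>b\<in>Poly_Mapping.keys p. h b (lookup p b)) + (\<Sum>b\<in>Poly_Mapping.keys q. h b (lookup q b))"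
proof -
  define S where "S = Poly_Mapping.keys p \<union> Poly_Mapping.keys q"
  have S: "(\<Sum>b\<in>Poly_Mapping.keys f. h b (lookup f b)) = (\<Sum>b\<in>S. h b (lookup f b))"
    if "Poly_Mapping.keys f \<subseteq> S" for f
    using that assms(1)
    by (intro sum.mono_neutral_left) (auto simp: S_def in_keys_iff)
  show ?thesis
    unfolding S[OF keys_add[of p q, folded S_def]]
    by (simp add: S S_def lookup_add assms sum.distrib)
qed

lemma Const_1 [simp]: "Const 1 = 1"
  by (simp add: Const_def)

lemma Const_0 [simp]: "Const 0 = 0"
  by (simp add: Const_def)

lemma Const_add: "Const (c + d) = Const c + Const d"
  by (simp add: Const_def single_add)

lemma Const_mult: "Const (c * d) = Const c * Const d"
  by (simp add: Const_def mult_single)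

lemma of_int_eq_Const: "(of_int k :: 'v cpoly) = Const (of_int k)"
  by (simp add: Const_def)

lemma Var_power: "Var v ^ k = single (single v k) 1"
  by (induction k) (simp_all add: Var_def mult_single single_add[symmetric])

lemma prod_single: "(\<Prod>i\<in>I. single (b i) (1::complex)) = single (\<Sum>i\<in>I. b i) 1"
  by (induction I rule: infinite_finite_induct) (simp_all add: mult_single)

lemma exponent_eq_sum_single:
  fixes b :: "'v::finite \<Rightarrow>\<^sub>0 nat"
  shows "(\<Sum>v\<in>UNIV. single v (lookup b v)) = b"
  by (rule poly_mapping_eqI) (simp add: lookup_sum lookup_single when_def)

text \<open>
  The polynomials are generated as a ring by the constants and the variables. In this form induction
  suits the chain rule, which holds for products as soon as it holds for the factors.
\<close>

lemma cpoly_induct [case_names Const Var add mult]: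
  fixes p :: "'v::finite cpoly"
  assumes "\<And>c. P (Const c)" "\<And>v. P (Var v)"
    and "\<And>p q. P p \<Longrightarrow> P q \<Longrightarrow> P (p + q)" and "\<And>p q. P p \<Longrightarrow> P q \<Longrightarrow> P (p * q)"
  shows "P p"
proof (induction p rule: cpoly_add_induct)
  case (single b c)
  have one: "P 1" using assms(1)[of 1] by simp
  have pow: "P (Var v ^ k)" for v k
    by (induction k) (use one assms in auto)
  have "P (\<Prod>v\<in>S. Var v ^ lookup b v)" for S
    by (induction S rule: infinite_finite_induct) (use one pow assms in auto)
  then have "P (Const c * (\<Prod>v\<in>UNIV. Var v ^ lookup b v))"
    using assms by blast
  also have "Const c * (\<Prod>v\<in>UNIV. Var v ^ lookup b v) = single b c"
    by (simp add: Var_power prod_single exponent_eq_sum_single Const_def mult_single)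
  finally show ?case .
qed (rule assms(3))

lemma partial_deriv_add: "partial_deriv v (p + q) = partial_deriv v p + partial_deriv v q"
  unfolding partial_deriv_def
  by (rule sum_keys_add[of "\<lambda>b c. single (b - single v 1) (of_nat (lookup b v) * c)"])
    (simp_all add: algebra_simps single_add)

lemma partial_deriv_single:
  "partial_deriv v (single b c) = single (b - single v 1) (of_nat (lookup b v) * c)"
  by (simp add: partial_deriv_def)

lemma partial_deriv_mult_single:
  fixes a b :: "'v \<Rightarrow>\<^sub>0 nat"
  shows "partial_deriv v (single a c * single b d)
     = partial_deriv v (single a c) * single b d + single a c * partial_deriv v (single b d)"
proof -
  \<comment> \<open>Truncated subtraction of exponents commutes with addition if \<open>v\<close> occurs in \<open>x\<close>; where it does not,
    the coefficient produced by the derivative is zero.\<close>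
  have shift: "x - single v 1 + y = x + y - single v 1" if "lookup x v \<noteq> 0" for x y :: "'v \<Rightarrow>\<^sub>0 nat"
    by (rule poly_mapping_eqI) (use that in \<open>auto simp: lookup_add lookup_minus lookup_single when_def\<close>)
  have 1: "single (a - single v 1 + b) (of_nat (lookup a v) * (c * d))
      = single (a + b - single v 1) (of_nat (lookup a v) * (c * d))"
    by (cases "lookup a v = 0") (simp, simp only: shift not_False_eq_True)
  have 2: "single (a + (b - single v 1)) (of_nat (lookup b v) * (c * d))
      = single (a + b - single v 1) (of_nat (lookup b v) * (c * d))"
    by (cases "lookup b v = 0") (simp, simp only: shift add.commute[of a] not_False_eq_True)
  have "partial_deriv v (single a c * single b d)
      = single (a - single v 1 + b) (of_nat (lookup a v) * (c * d))
      + single (a + (b - single v 1)) (of_nat (lookup b v) * (c * d))"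
    unfolding 1 2 by (simp add: mult_single partial_deriv_single lookup_add algebra_simps flip: single_add)
  then show ?thesis
    by (simp add: mult_single partial_deriv_single ac_simps)
qed

lemma partial_deriv_mult: "partial_deriv v (p * q) = partial_deriv v p * q + p * partial_deriv v q"
proof (induction p rule: cpoly_add_induct)
  case (single a c)
  show ?case
    by (induction q rule: cpoly_add_induct)
      (simp_all add: partial_deriv_mult_single partial_deriv_add algebra_simps)
qed (simp add: partial_deriv_add algebra_simps)

lemma partial_deriv_Const [simp]: "partial_deriv v (Const c) = 0"
  by (simp add: Const_def partial_deriv_single)

lemma partial_deriv_Var: "partial_deriv v (Var w) = (if v = w then 1 else 0)"
  by (simp add: Var_def partial_deriv_single lookup_single)

lemma partial_deriv_power: "partial_deriv v (p ^ k) = of_nat k * p ^ (k - 1) * partial_deriv v p"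
proof (induction k)
  case 0
  show ?case using partial_deriv_Const[of v 1] by simp
next
  case (Suc k)
  then show ?case
    by (cases k) (simp_all add: partial_deriv_mult algebra_simps)
qed

lemma subst_single:
  fixes \<sigma> :: "'v::finite \<Rightarrow> 'w cpoly"
  shows "subst \<sigma> (single b c) = Const c * (\<Prod>v\<in>UNIV. \<sigma> v ^ lookup b v)"
proof -
  have "(\<Prod>v\<in>Poly_Mapping.keys b. \<sigma> v ^ lookup b v) = (\<Prod>v\<in>UNIV. \<sigma> v ^ lookup b v)"
    by (rule prod.mono_neutral_left) (auto simp: in_keys_iff)
  then show ?thesis by (simp add: subst_def)
qed

lemma subst_add: "subst \<sigma> (p + q) = subst \<sigma> p + subst \<sigma> q"
  unfolding subst_def
  by (rule sum_keys_add[of "\<lambda>b c. Const c * (\<Prod>v\<in>Poly_Mapping.keys b. \<sigma> v ^ lookup b v)"])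
    (simp_all add: Const_add algebra_simps)

lemma subst_mult:
  fixes \<sigma> :: "'v::finite \<Rightarrow> 'w cpoly"
  shows "subst \<sigma> (p * q) = subst \<sigma> p * subst \<sigma> q"
proof (induction p rule: cpoly_add_induct)
  case (single a c)
  show ?case
    by (induction q rule: cpoly_add_induct)
      (simp_all add: subst_single mult_single Const_mult lookup_add power_add prod.distrib mult_ac
        subst_add distrib_left distrib_right)
next
  case (add p p')
  then show ?case by (simp only: subst_add distrib_right)
qed

lemma subst_Const [simp]:
  fixes \<sigma> :: "'v::finite \<Rightarrow> 'w cpoly"
  shows "subst \<sigma> (Const c) = Const c"
  using subst_single[of \<sigma> 0 c] by (simp add: Const_def)

lemma subst_1 [simp]:
  fixes \<sigma> :: "'v::finite \<Rightarrow> 'w cpoly"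
  shows "subst \<sigma> 1 = 1"
  using subst_Const[of \<sigma> 1] by simp

lemma subst_0 [simp]: "subst \<sigma> 0 = 0"
  by (simp add: subst_def)

lemma subst_of_int [simp]:
  fixes \<sigma> :: "'v::finite \<Rightarrow> 'w cpoly"
  shows "subst \<sigma> (of_int k) = of_int k"
  by (simp add: of_int_eq_Const)

lemma subst_Var [simp]:
  fixes \<sigma> :: "'v::finite \<Rightarrow> 'w cpoly"
  shows "subst \<sigma> (Var v) = \<sigma> v"
  by (simp add: Var_def subst_single lookup_single when_def if_distrib[of "\<lambda>k. _ ^ k"] cong: if_cong)

lemma subst_sum: "subst \<sigma> (\<Sum>i\<in>I. f i) = (\<Sum>i\<in>I. subst \<sigma> (f i))"
  by (induction I rule: infinite_finite_induct) (simp_all add: subst_add)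

lemma subst_prod:
  fixes \<sigma> :: "'v::finite \<Rightarrow> 'w cpoly"
  shows "subst \<sigma> (\<Prod>i\<in>I. f i) = (\<Prod>i\<in>I. subst \<sigma> (f i))"
  by (induction I rule: infinite_finite_induct) (simp_all add: subst_mult)

lemma subst_det:
  fixes \<sigma> :: "'v::finite \<Rightarrow> 'w cpoly"
  shows "subst \<sigma> (det A) = det (\<chi> i j. subst \<sigma> (A $ i $ j))"
  by (simp add: det_def subst_sum subst_mult subst_prod)

lemma partial_deriv_subst:
  fixes \<sigma> :: "'v::finite \<Rightarrow> 'w::finite cpoly"
  shows "partial_deriv w (subst \<sigma> p) = (\<Sum>v\<in>UNIV. subst \<sigma> (partial_deriv v p) * partial_deriv w (\<sigma> v))"
proof (induction p rule: cpoly_induct)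
  case (Var v)
  have "(\<Sum>x\<in>UNIV. subst \<sigma> (partial_deriv x (Var v)) * partial_deriv w (\<sigma> x))
      = (\<Sum>x\<in>UNIV. if x = v then partial_deriv w (\<sigma> x) else 0)"
    by (rule sum.cong) (auto simp: partial_deriv_Var)
  then show ?case by simp
qed (simp_all add: subst_add subst_mult partial_deriv_add partial_deriv_mult
      distrib_left distrib_right sum.distrib sum_distrib_left sum_distrib_right mult_ac)

section \<open>The substitution of the weight-zero monomials\<close>

text \<open>
  Multiplication by a monomial shifts the coefficients, so it is injective.
\<close>

lemma Var_power_mult_cancel:
  fixes p q :: "'v cpoly"
  assumes "Var v ^ k * p = Var v ^ k * q"
  shows "p = q"
proof -
  have "lookup (single a 1 * f) (a + b) = lookup f b" for a b :: "'v \<Rightarrow>\<^sub>0 nat" and f :: "'v cpoly"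
    by (induction f rule: cpoly_add_induct)
      (simp_all add: mult_single lookup_single distrib_left lookup_add)
  then show ?thesis
    using assms unfolding Var_power by (metis poly_mapping_eqI)
qed

text \<open>
  The substitution turns \<open>u\<^sup>b\<close> into \<open>x\<^sup>e y\<^sup>b\<close>, where \<open>e\<close> is the sum of the \<open>r\<^sub>i b\<^sub>i\<close>. The exponent of
  \<open>y\<close> determines \<open>b\<close>, which makes the substitution injective; the exponent of \<open>x\<close> is the quantity
  bounded below in the definition of \<^const>\<open>V\<close>, which makes the division by \<open>x\<^sup>r\<close> possible.
\<close>

definition u_exponent :: "('n::finite \<Rightarrow> nat) \<Rightarrow> ('n \<Rightarrow>\<^sub>0 nat) \<Rightarrow> 'n option \<Rightarrow>\<^sub>0 nat" where
  "u_exponent r b = single None (\<Sum>i\<in>UNIV. r i * lookup b i)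
     + (\<Sum>i\<in>UNIV. single (Some i) (lookup b i))"

lemma lookup_u_exponent_Some: "lookup (u_exponent r b) (Some i) = lookup b i"
  by (simp add: u_exponent_def lookup_add lookup_sum lookup_single when_def)

lemma inj_u_exponent:
  fixes r :: "'n::finite \<Rightarrow> nat"
  shows "inj (u_exponent r)"
  by (rule injI) (metis lookup_u_exponent_Some poly_mapping_eqI)

lemma single_sum: "single v (\<Sum>i\<in>I. f i) = (\<Sum>i\<in>I. single v (f i))"
  by (induction I rule: infinite_finite_induct) (simp_all add: single_add)

lemma subst_u_single:
  fixes r :: "'n::finite \<Rightarrow> nat"
  shows "subst (u r) (single b c) = single (u_exponent r b) c"
proof -
  have "(\<Prod>i\<in>UNIV. u r i ^ lookup b i)
      = (\<Prod>i\<in>UNIV. Var None ^ (r i * lookup b i)) * (\<Prod>i\<in>UNIV. Var (Some i) ^ lookup b i)"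
    by (simp add: u_def power_mult_distrib power_mult prod.distrib)
  also have "\<dots> = single (u_exponent r b) 1"
    by (simp add: power_sum[symmetric] Var_power prod_single mult_single u_exponent_def single_sum)
  finally show ?thesis
    by (simp add: subst_single Const_def mult_single)
qed

lemma inj_subst_u:
  fixes r :: "'n::finite \<Rightarrow> nat"
  shows "inj (subst (u r))"
proof (rule injI)
  have "lookup (subst (u r) p) (u_exponent r b) = lookup p b" for p b
    by (induction p rule: cpoly_add_induct)
      (simp_all add: subst_u_single subst_add lookup_add lookup_single inj_eq[OF inj_u_exponent])
  then show "p = q" if "subst (u r) p = subst (u r) q" for p q
    using that by (metis poly_mapping_eqI)
qed

lemma V_imp_Var_power_dvd:
  assumes "p \<in> V r j"
  shows "\<exists>q. Var None ^ r j * q = subst (u r) p"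
proof -
  interpret vector_space "scale :: complex \<Rightarrow> 'a cpoly \<Rightarrow> 'a cpoly"
    by (rule vector_space_scale)
  define T where "T = {p. \<exists>q. Var None ^ r j * q = subst (u r) p}"
  have "subspace T"
  proof (rule subspaceI)
    show "0 \<in> T" by (auto simp: T_def intro: exI[of _ 0])
    show "p + q \<in> T" if pq: "p \<in> T" "q \<in> T" for p q
    proof -
      obtain p' q' where "Var None ^ r j * p' = subst (u r) p" "Var None ^ r j * q' = subst (u r) q"
        using pq unfolding T_def by blast
      then have "Var None ^ r j * (p' + q') = subst (u r) (p + q)"
        by (simp add: subst_add distrib_left)
      then show ?thesis by (auto simp: T_def)
    qed
    show "scale c p \<in> T" if p: "p \<in> T" for c p
    proof -
      obtain q where "Var None ^ r j * q = subst (u r) p"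
        using p unfolding T_def by blast
      then have "Var None ^ r j * (Const c * q) = subst (u r) (scale c p)"
        by (simp add: scale_def subst_mult mult.left_commute)
      then show ?thesis by (auto simp: T_def)
    qed
  qed
  moreover have "{single b 1 | b. (\<Sum>i\<in>UNIV. r i * lookup b i) \<ge> r j} \<subseteq> T"
  proof clarify
    fix b :: "'a \<Rightarrow>\<^sub>0 nat"
    assume le: "r j \<le> (\<Sum>i\<in>UNIV. r i * lookup b i)"
    have "u_exponent r b = single None (r j) + (single None ((\<Sum>i\<in>UNIV. r i * lookup b i) - r j)
        + (\<Sum>i\<in>UNIV. single (Some i) (lookup b i)))"
      using le by (simp add: u_exponent_def single_add[symmetric] flip: add.assoc)
    then show "single b 1 \<in> T"
      by (auto simp: T_def subst_u_single Var_power mult_single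
          intro!: exI[of _ "single (single None ((\<Sum>i\<in>UNIV. r i * lookup b i) - r j)
        + (\<Sum>i\<in>UNIV. single (Some i) (lookup b i))) 1"])
  qed
  ultimately have "V r j \<subseteq> T"
    unfolding V_def by (intro span_minimal)
  then show ?thesis using assms by (auto simp: T_def)
qed

lemma G_Some:
  assumes "B j \<in> V r j"
  shows "Var None ^ r j * G r B \<Lambda> (Some j) = subst (u r) (B j)"
proof -
  obtain q where "Var None ^ r j * q = subst (u r) (B j)"
    using V_imp_Var_power_dvd[OF assms] by blast
  then have "\<exists>!q. Var None ^ r j * q = subst (u r) (B j)"
    using Var_power_mult_cancel by metis
  then show ?thesis
    unfolding G.simps by (rule theI')
qed

section \<open>The polynomial \<open>\<mu>\<close> as a determinant\<close>

text \<open>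
  If \<open>F\<close> has weight \<open>\<omega>\<close> and corresponds to \<open>p\<close>, that is \<open>F = x\<^sup>\<omega> p(u)\<close>, then this vector, evaluated
  at \<open>u\<close>, lists up to powers of \<open>x\<close> the derivatives of \<open>F\<close> along the vector field \<open>x \<partial>\<^sub>x - \<Sum> r\<^sub>k y\<^sub>k \<partial>\<^sub>y\<^sub>k\<close>, which annihilates
  every \<open>u\<^sub>i\<close>, and along the \<open>\<partial>\<^sub>y\<^sub>k\<close>.
\<close>

definition weighted_gradient :: "int \<Rightarrow> 'n cpoly \<Rightarrow> 'n cpoly ^ 'n::finite option" where
  "weighted_gradient \<omega> p = (\<chi> k. case k of None \<Rightarrow> of_int \<omega> * p | Some j \<Rightarrow> partial_deriv j p)"

definition weighted_Jac :: "('n::finite option \<Rightarrow> int) \<Rightarrow> ('n option \<Rightarrow> 'n cpoly) \<Rightarrow> 'n cpoly" where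
  "weighted_Jac \<omega> A = det (\<chi> i. weighted_gradient (\<omega> i) (A i))"

text \<open>
  The weights of the components \<open>x \<Lambda>(u), x\<^sup>-\<^sup>r\<^sup>j B\<^sub>j(u)\<close> of \<^const>\<open>G\<close>.
\<close>

definition weight :: "('n \<Rightarrow> nat) \<Rightarrow> 'n option \<Rightarrow> int" where
  "weight r i = (case i of None \<Rightarrow> 1 | Some j \<Rightarrow> - int (r j))"

lemma weighted_gradient_add:
  "weighted_gradient \<omega> (p + q) = weighted_gradient \<omega> p + weighted_gradient \<omega> q"
  by (simp add: weighted_gradient_def vec_eq_iff partial_deriv_add distrib_left split: option.split)

lemma weighted_gradient_scale:
  "weighted_gradient \<omega> (scale c p) = Const c *s weighted_gradient \<omega> p"
  by (simp add: weighted_gradient_def vec_eq_iff scale_def partial_deriv_mult split: option.split)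

text \<open>
  The definition of \<^const>\<open>mu\<close> is the expansion of this determinant along the column of the weights. The
  weights \<open>- r\<^sub>j\<close> cancel the signs of the expansion.
\<close>

lemma mu_eq_weighted_Jac: "mu r B \<Lambda> = weighted_Jac (weight r) (case_option \<Lambda> B)"
proof -
  let ?A = "case_option \<Lambda> B"
  let ?M = "\<chi> i. weighted_gradient (weight r i) (?A i)"
  have "Jac B = det (\<chi> i j. ?M $ Some i $ Some j)"
    by (simp add: Jac_def weighted_gradient_def)
  moreover have "Jac (B(k := \<Lambda>)) = det (\<chi> i j. if i = k then ?M $ None $ Some j else ?M $ Some i $ Some j)" for k
    unfolding Jac_def by (rule arg_cong[where f = det]) (simp add: vec_eq_iff weighted_gradient_def)
  ultimately show ?thesis
    unfolding mu_def weighted_Jac_def det_expand_None[of ?M]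
    by (simp add: weighted_gradient_def weight_def sum_negf)
qed

text \<open>
  Each argument occurs in one row only, and that row depends linearly on it.
\<close>

lemma multilinear_weighted_Jac: "multilinear (weighted_Jac \<omega>)"
  unfolding multilinear_def Vector_Spaces.linear_iff
proof (intro allI conjI vector_space_scale)
  fix A :: "'a option \<Rightarrow> 'a cpoly" and k p q c
  have row: "weighted_Jac \<omega> (A(k := p))
      = det (\<chi> i. if i = k then weighted_gradient (\<omega> k) p else weighted_gradient (\<omega> i) (A i))" for p
    unfolding weighted_Jac_def by (rule arg_cong[where f = det]) (simp add: vec_eq_iff)
  show "weighted_Jac \<omega> (A(k := p + q)) = weighted_Jac \<omega> (A(k := p)) + weighted_Jac \<omega> (A(k := q))"
    unfolding row weighted_gradient_add by (rule det_row_add)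
  show "weighted_Jac \<omega> (A(k := scale c p)) = scale c (weighted_Jac \<omega> (A(k := p)))"
    unfolding row weighted_gradient_scale scale_def[of c "det _"] by (rule det_row_mul)
qed

lemma Const_prod: "Const (\<Prod>i\<in>I. c i) = (\<Prod>i\<in>I. Const (c i))"
  by (induction I rule: infinite_finite_induct) (simp_all add: Const_mult)

lemma multihomogeneous_weighted_Jac: "multihomogeneous (\<lambda>_. 1) (weighted_Jac \<omega>)"
  unfolding multihomogeneous_def weighted_Jac_def weighted_gradient_scale
  by (simp add: det_rows_mul scale_def Const_prod)

section \<open>The Jacobian of powers of \<open>\<Lambda>\<close> times \<open>B\<close>\<close>

text \<open>
  By the product rule, row \<open>i\<close> of the Jacobian matrix is \<open>\<Lambda>\<^bsup>r\<^sub>i - 1\<^esup>\<close> times \<open>\<Lambda> \<nabla>B\<^sub>i + r\<^sub>i B\<^sub>i \<nabla>\<Lambda>\<close>. The second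
  factors are a rank-one update of \<open>\<Lambda>\<close> times the Jacobian matrix of \<open>B\<close>, in direction \<open>\<nabla>\<Lambda>\<close>. With
  \<open>N = n - 1\<close> rows, its determinant is \<open>\<Lambda>\<^bsup>N - 1\<^esup> \<mu>\<close>.
\<close>

lemma Jac_mult_powers:
  fixes r :: "'n::finite \<Rightarrow> nat"
  assumes "\<And>i. r i > 0"
  shows "Jac (\<lambda>i. B i * \<Lambda> ^ r i) = \<Lambda> ^ ((\<Sum>i\<in>UNIV. r i) - 1) * mu r B \<Lambda>"
proof -
  define N where "N = CARD('n)"
  define a where "a i = (\<chi> j. partial_deriv j (B i))" for i
  define w where "w = (\<chi> j. partial_deriv j \<Lambda>)"
  have N: "N > 0" by (simp add: N_def)
  have Jac_B: "Jac B = det (\<chi> i. a i)"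
    by (simp add: Jac_def a_def)
  have Jac_upd: "Jac (B(k := \<Lambda>)) = det (\<chi> i. if i = k then w else a i)" for k
    unfolding Jac_def by (rule arg_cong[where f = det]) (simp add: vec_eq_iff a_def w_def)
  have "Jac (\<lambda>i. B i * \<Lambda> ^ r i)
      = det (\<chi> i. \<Lambda> ^ (r i - 1) *s (\<Lambda> *s a i + (of_nat (r i) * B i) *s w))"
  proof -
    have "partial_deriv j (B i * \<Lambda> ^ r i)
        = \<Lambda> ^ (r i - 1) * (\<Lambda> * partial_deriv j (B i) + of_nat (r i) * B i * partial_deriv j \<Lambda>)" for i j
    proof -
      have "\<Lambda> ^ r i = \<Lambda> ^ (r i - 1) * \<Lambda>"
        using assms[of i] by (simp add: power_eq_if mult.commute)
      then show ?thesis
        unfolding partial_deriv_mult partial_deriv_power by (simp only:) (simp add: algebra_simps)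
    qed
    then show ?thesis
      unfolding Jac_def by (intro arg_cong[where f = det]) (simp add: vec_eq_iff a_def w_def)
  qed
  also have "\<dots> = \<Lambda> ^ (\<Sum>i\<in>UNIV. r i - 1) * det (\<chi> i. \<Lambda> *s a i + (of_nat (r i) * B i) *s w)"
    by (simp add: det_rows_mul power_sum)
  also have "det (\<chi> i. \<Lambda> *s a i + (of_nat (r i) * B i) *s w)
     = det (\<chi> i. \<Lambda> *s a i) + (\<Sum>k\<in>UNIV. of_nat (r k) * B k * det (\<chi> i. if i = k then w else \<Lambda> *s a i))"
    by (rule det_rank_one_update)
  also have "det (\<chi> i. \<Lambda> *s a i) = \<Lambda> ^ N * Jac B"
    by (simp add: det_rows_mul Jac_B N_def)
  also have "(\<lambda>k. det (\<chi> i. if i = k then w else \<Lambda> *s a i)) = (\<lambda>k. \<Lambda> ^ (N - 1) * Jac (B(k := \<Lambda>)))"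
  proof
    fix k
    have "(\<chi> i. if i = k then w else \<Lambda> *s a i)
        = (\<chi> i. (if i = k then 1 else \<Lambda>) *s (if i = k then w else a i))"
      by (simp add: vec_eq_iff)
    moreover have "(\<Prod>i\<in>UNIV. if i = k then 1 else \<Lambda>) = \<Lambda> ^ (N - 1)"
      by (subst prod.remove[of _ k]) (simp_all add: N_def card_Diff_singleton)
    ultimately show "det (\<chi> i. if i = k then w else \<Lambda> *s a i) = \<Lambda> ^ (N - 1) * Jac (B(k := \<Lambda>))"
      by (simp only: det_rows_mul Jac_upd)
  qed
  \<comment> \<open>\<open>\<Lambda>\<close> may be zero, so powers of it are collected and never cancelled.\<close>
  also have "\<Lambda> ^ (\<Sum>i\<in>UNIV. r i - 1) * (\<Lambda> ^ N * Jac B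
        + (\<Sum>k\<in>UNIV. of_nat (r k) * B k * (\<Lambda> ^ (N - 1) * Jac (B(k := \<Lambda>)))))
      = \<Lambda> ^ ((\<Sum>i\<in>UNIV. r i - 1) + (N - 1)) * mu r B \<Lambda>"
  proof -
    have "\<Lambda> ^ N = \<Lambda> ^ (N - 1) * \<Lambda>"
      using N by (simp add: power_eq_if mult.commute)
    then show ?thesis
      by (simp add: mu_def power_add sum_distrib_left distrib_left mult_ac)
  qed
  also have "(\<Sum>i\<in>UNIV. r i - 1) + (N - 1) = (\<Sum>i\<in>UNIV. r i) - 1"
  proof -
    have "(\<Sum>i\<in>UNIV. r i) = (\<Sum>i\<in>UNIV. (r i - 1) + 1)"
      using assms by (intro sum.cong) (auto simp: Suc_leI)
    also have "\<dots> = (\<Sum>i\<in>UNIV. r i - 1) + N"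
      by (simp only: sum.distrib) (simp add: N_def)
    finally show ?thesis using N by simp
  qed
  finally show ?thesis .
qed

section \<open>The Jacobian of a weight-homogeneous map\<close>

text \<open>
  The operator \<open>x \<partial>\<^sub>x\<close> multiplies \<open>x\<^sup>k\<close> by \<open>k\<close>, also for \<open>k = 0\<close>. Using it in place of \<open>\<partial>\<^sub>x\<close> avoids
  exponents \<open>k - 1\<close> throughout.
\<close>

lemma Euler_deriv_power: "Var v * partial_deriv v (Var v ^ k) = of_nat k * Var v ^ k"
  unfolding partial_deriv_power by (cases k) (simp_all add: partial_deriv_Var mult_ac)

lemma Euler_deriv_Var_power:
  "Var v * partial_deriv v (Var v ^ k * p) = Var v ^ k * (of_nat k * p + Var v * partial_deriv v p)"
  by (simp add: partial_deriv_mult distrib_left Euler_deriv_power flip: mult.assoc)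

lemma partial_deriv_u_Some:
  "partial_deriv (Some k) (u r i) = (if i = k then Var None ^ r i else 0)"
  by (simp add: u_def partial_deriv_mult partial_deriv_power partial_deriv_Var)

lemma Euler_deriv_u: "Var None * partial_deriv None (u r i) = of_nat (r i) * u r i"
  unfolding u_def Euler_deriv_Var_power by (simp add: partial_deriv_Var mult_ac)

lemma partial_deriv_Some_subst_u:
  fixes r :: "'n::finite \<Rightarrow> nat"
  shows "partial_deriv (Some k) (subst (u r) p) = subst (u r) (partial_deriv k p) * Var None ^ r k"
  by (simp add: partial_deriv_subst partial_deriv_u_Some if_distrib[of "\<lambda>x. _ * x"] cong: if_cong)

lemma Euler_deriv_subst_u:
  fixes r :: "'n::finite \<Rightarrow> nat"
  shows "Var None * partial_deriv None (subst (u r) p)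
    = (\<Sum>k\<in>UNIV. of_nat (r k) * u r k * subst (u r) (partial_deriv k p))"
  by (simp add: partial_deriv_subst sum_distrib_left mult.left_commute[of "Var None"] Euler_deriv_u)
    (simp add: mult_ac)

text \<open>
  The components \<open>F\<^sub>i\<close> equal \<open>x\<^bsup>b\<^sub>i - a\<^sub>i\<^esup> A\<^sub>i(u)\<close>; both exponents are kept so that no negative power of
  \<open>x\<close> has to be written. In the Jacobian matrix, replace the column of \<open>\<partial>\<^sub>x\<close> by the derivatives along
  \<open>x \<partial>\<^sub>x - \<Sum> r\<^sub>k y\<^sub>k \<partial>\<^sub>y\<^sub>k\<close>. Since this field annihilates every \<open>u\<^sub>i\<close>, it multiplies \<open>F\<^sub>i\<close> by its weight
  \<open>b\<^sub>i - a\<^sub>i\<close>. On the other hand \<open>\<partial>\<^sub>y\<^sub>k\<close> acts on \<open>A\<^sub>i(u)\<close> as \<open>x\<^bsup>r\<^sub>k\<^esup>\<close> times the substituted \<open>\<partial>\<^sub>k A\<^sub>i\<close>. Hence,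
  up to powers of \<open>x\<close> that multiply rows and columns, the result is the matrix of
  \<^const>\<open>weighted_Jac\<close>. The condition on the weights says that these powers balance, so that they
  can be cancelled.
\<close>

lemma Jac_weight_homogeneous:
  fixes r :: "'n::finite \<Rightarrow> nat" and A :: "'n option \<Rightarrow> 'n cpoly"
    and F :: "'n option \<Rightarrow> 'n option cpoly"
  assumes F: "\<And>i. Var None ^ a i * F i = Var None ^ b i * subst (u r) (A i)"
    and weights: "(\<Sum>i\<in>UNIV. a i) + 1 = (\<Sum>i\<in>UNIV. b i) + (\<Sum>k\<in>UNIV. r k)"
  shows "Jac F = subst (u r) (weighted_Jac (\<lambda>i. int (b i) - int (a i)) A)"
proof -
  define x :: "'n option cpoly" where "x = Var None"
  define y :: "'n \<Rightarrow> 'n option cpoly" where "y k = Var (Some k)" for k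
  \<comment> \<open>Multiplication by \<open>E\<close> on the right is the change of the column of \<open>\<partial>\<^sub>x\<close>; \<open>D\<close> collects the factors
    \<open>x\<^bsup>r\<^sub>k\<^esup>\<close> of the columns of the \<open>\<partial>\<^sub>y\<^sub>k\<close>.\<close>
  define J where "J = (\<chi> i j. partial_deriv j (F i))"
  define W where "W = (\<chi> i j. subst (u r) (weighted_gradient (int (b i) - int (a i)) (A i) $ j))"
  define E :: "'n option cpoly ^ 'n option ^ 'n option" where
    "E = (\<chi> i j. case j of None \<Rightarrow> (case i of None \<Rightarrow> x | Some k \<Rightarrow> - (of_nat (r k) * y k))
        | Some l \<Rightarrow> (if i = j then 1 else 0))"
  define D :: "'n option cpoly ^ 'n option ^ 'n option" where
    "D = (\<chi> i j. if i = j then (case j of None \<Rightarrow> 1 | Some k \<Rightarrow> x ^ r k) else 0)"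
  have deriv_y: "x ^ a i * partial_deriv (Some k) (F i)
      = x ^ b i * (subst (u r) (partial_deriv k (A i)) * x ^ r k)" for i k
  proof -
    have "partial_deriv (Some k) (x ^ c * p) = x ^ c * partial_deriv (Some k) p" for c p
      by (simp add: partial_deriv_mult partial_deriv_power partial_deriv_Var x_def)
    then show ?thesis
      using arg_cong[OF F[of i], of "partial_deriv (Some k)"]
      by (simp add: partial_deriv_Some_subst_u x_def)
  qed
  have deriv_x: "x ^ a i * (of_nat (a i) * F i + x * partial_deriv None (F i))
      = x ^ b i * (of_nat (b i) * subst (u r) (A i)
          + (\<Sum>k\<in>UNIV. of_nat (r k) * u r k * subst (u r) (partial_deriv k (A i))))" for i
    using arg_cong[OF F[of i], of "\<lambda>p. Var None * partial_deriv None p"]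
    by (simp add: Euler_deriv_Var_power Euler_deriv_subst_u x_def)
  have "x ^ a i * (J ** E) $ i $ j = x ^ b i * (W ** D) $ i $ j" for i j
  proof (cases j)
    case (Some k)
    have "(J ** E) $ i $ j = partial_deriv (Some k) (F i)"
      by (simp add: matrix_matrix_mult_def J_def E_def Some if_distrib[of "\<lambda>x. _ * x"] cong: if_cong)
    moreover have "(W ** D) $ i $ j = subst (u r) (partial_deriv k (A i)) * x ^ r k"
      by (simp add: matrix_matrix_mult_def W_def D_def Some weighted_gradient_def
          if_distrib[of "\<lambda>x. _ * x"] cong: if_cong)
    ultimately show ?thesis by (simp only: deriv_y)
  next
    case None
    have JE: "(J ** E) $ i $ j = x * partial_deriv None (F i)
        - (\<Sum>k\<in>UNIV. of_nat (r k) * y k * partial_deriv (Some k) (F i))"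
      by (simp add: matrix_matrix_mult_def sum_option_UNIV J_def E_def None sum_negf mult_ac)
    have WD: "(W ** D) $ i $ j = (of_nat (b i) - of_nat (a i)) * subst (u r) (A i)"
      by (simp add: matrix_matrix_mult_def W_def D_def None weighted_gradient_def subst_mult
          if_distrib[of "\<lambda>x. _ * x"] del: of_int_diff cong: if_cong) simp
    have "x ^ a i * (\<Sum>k\<in>UNIV. of_nat (r k) * y k * partial_deriv (Some k) (F i))
        = (\<Sum>k\<in>UNIV. of_nat (r k) * y k * (x ^ a i * partial_deriv (Some k) (F i)))"
      by (simp add: sum_distrib_left mult_ac)
    also have "\<dots> = x ^ b i * (\<Sum>k\<in>UNIV. of_nat (r k) * u r k * subst (u r) (partial_deriv k (A i)))"
      unfolding deriv_y by (simp add: sum_distrib_left u_def x_def y_def mult_ac)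
    finally have "x ^ a i * (J ** E) $ i $ j
        = x ^ b i * (of_nat (b i) * subst (u r) (A i)) - of_nat (a i) * (x ^ a i * F i)"
      unfolding JE using deriv_x[of i] by (simp add: algebra_simps)
    also have "x ^ a i * F i = x ^ b i * subst (u r) (A i)"
      using F[of i] by (simp add: x_def)
    finally show ?thesis
      unfolding WD by (simp add: algebra_simps)
  qed
  then have "det (\<chi> i. x ^ a i *s (J ** E) $ i) = det (\<chi> i. x ^ b i *s (W ** D) $ i)"
    by (intro arg_cong[where f = det]) (simp add: vec_eq_iff)
  then have "(\<Prod>i\<in>UNIV. x ^ a i) * det (J ** E) = (\<Prod>i\<in>UNIV. x ^ b i) * det (W ** D)"
    by (simp add: det_rows_mul)
  moreover have "det E = x"
  proof -
    have "(\<chi> i j. E $ Some i $ Some j) = mat 1"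
      by (simp add: E_def mat_def vec_eq_iff)
    then show ?thesis
      by (subst det_block_lower) (simp_all add: E_def)
  qed
  moreover have "det D = x ^ (\<Sum>k\<in>UNIV. r k)"
    by (subst det_diagonal) (simp_all add: D_def prod_option_UNIV power_sum)
  ultimately have "x ^ ((\<Sum>i\<in>UNIV. a i) + 1) * det J
      = x ^ ((\<Sum>i\<in>UNIV. b i) + (\<Sum>k\<in>UNIV. r k)) * det W"
    by (simp add: det_mul power_add power_sum mult_ac)
  then have "det J = det W"
    unfolding weights x_def by (rule Var_power_mult_cancel)
  then show ?thesis
    by (simp add: Jac_def J_def W_def weighted_Jac_def subst_det)
qed

lemma Jac_G:
  fixes r :: "'n::finite \<Rightarrow> nat"
  assumes "\<And>j. B j \<in> V r j"
  shows "Jac (G r B \<Lambda>) = subst (u r) (mu r B \<Lambda>)"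
proof -
  \<comment> \<open>The exponents are \<open>a = (0, r)\<close> and \<open>b = (1, 0, \<dots>, 0)\<close>; both sides of the condition on the weights
    are \<open>m + 1\<close>.\<close>
  have "Jac (G r B \<Lambda>) = subst (u r) (weighted_Jac
      (\<lambda>i. int (case_option 1 (\<lambda>_. 0) i) - int (case_option 0 r i)) (case_option \<Lambda> B))"
  proof (rule Jac_weight_homogeneous)
    fix i
    show "Var None ^ case_option 0 r i * G r B \<Lambda> i
        = Var None ^ case_option 1 (\<lambda>_. 0) i * subst (u r) (case_option \<Lambda> B i)"
    proof (cases i)
      case None
      then show ?thesis by simp
    next
      case (Some j)
      show ?thesis unfolding Some option.case G_Some[OF assms] by simp
    qed
  qed (simp add: sum_option_UNIV)
  also have "(\<lambda>i. int (case_option 1 (\<lambda>_. 0) i) - int (case_option 0 r i)) = weight r"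
    by (auto simp: weight_def split: option.split)
  finally show ?thesis by (simp add: mu_eq_weighted_Jac)
qed

text \<open>
  The substitution is injective and fixes the constants.
\<close>

lemma keller_map_G_iff:
  fixes r :: "'n::finite \<Rightarrow> nat"
  assumes "\<And>j. B j \<in> V r j"
  shows "keller_map (G r B \<Lambda>) \<longleftrightarrow> (\<exists>\<kappa>. \<kappa> \<noteq> 0 \<and> mu r B \<Lambda> = Const \<kappa>)"
proof -
  have "subst (u r) p = Const \<kappa> \<longleftrightarrow> p = Const \<kappa>" for p \<kappa>
    using inj_eq[OF inj_subst_u[of r], of p "Const \<kappa>"] by simp
  then show ?thesis by (simp add: keller_map_def Jac_G[OF assms])
qed

theorem theorem9p2:
  fixes r :: "'n::finite \<Rightarrow> nat"
    and \<Lambda> :: "'n cpoly"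
    and B :: "'n \<Rightarrow> 'n cpoly"
    and m :: nat
  assumes "CARD('n option) \<ge> 3"
    and "\<And>i. r i > 0"
    and "m = (\<Sum>i\<in>UNIV. r i)"
  shows "Jac (\<lambda>i. B i * \<Lambda> ^ r i) = \<Lambda> ^ (m - 1) * mu r B \<Lambda>
    \<and> ((\<forall>j. B j \<in> V r j) \<longrightarrow>
         (\<forall>j. Var None ^ r j * G r B \<Lambda> (Some j) = subst (u r) (B j))
         \<and> (keller_map (G r B \<Lambda>) \<longleftrightarrow> (\<exists>\<kappa>. \<kappa> \<noteq> 0 \<and> mu r B \<Lambda> = Const \<kappa>)))
    \<and> multilinear (\<lambda>A. mu r (\<lambda>i. A (Some i)) (A None))
    \<and> multihomogeneous (\<lambda>_. 1) (\<lambda>A. mu r (\<lambda>i. A (Some i)) (A None))"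
proof -
  have "case_option (A None) (\<lambda>i. A (Some i)) = A" for A :: "'n option \<Rightarrow> 'n cpoly"
    by (auto split: option.split)
  then have "(\<lambda>A. mu r (\<lambda>i. A (Some i)) (A None)) = weighted_Jac (weight r)"
    by (simp add: mu_eq_weighted_Jac)
  then show ?thesis
    using Jac_mult_powers[of r B \<Lambda>] assms(2,3) G_Some[of B _ r \<Lambda>] keller_map_G_iff[of B r \<Lambda>]
      multilinear_weighted_Jac[of "weight r"] multihomogeneous_weighted_Jac[of "weight r"]
    by (simp del: G.simps)
qed

end
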